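(* Every causet $(S,d)$ is a bounded Lorentzian-metric space, and its topology $\mathscr{T}$ is the discrete topology.
   Context: A causet is a finite set $S$ endowed with a function $d\colon S\times S\to[0,\infty)$ such that (i) if $d(x,y)>0$ and $d(y,z)>0$ then $d(x,z)\ge d(x,y)+d(y,z)$, and (iii) for every $x\ne y$ in $S$ there is $z\in S$ with $d(x,z)\ne d(y,z)$ or $d(z,x)\ne d(z,y)$. A bounded Lorentzian-metric space $(X,d)$ is a set $X$ with a map $d\colon X\times X\to[0,\infty)$ satisfying (i), (iii) (for $X$ in place of $S$) and (ii): there is a topology $T$ on $X$ such that $d$ is continuous for $T\times T$ and for every $\epsilon>0$ the set $\{(p,q): d(p,q)\ge\epsilon\}$ is compact for $T\times T$. The topology $\mathscr{T}$ of $(X,d)$ is the intersection of all topologies $T$ as in (ii). *)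

theory Defs
  imports "HOL-Analysis.Analysis"
begin

text \<open>
  Spaces are carrier sets \<open>X :: 'a set\<close>; the values of \<open>d :: 'a \<times> 'a \<Rightarrow> real\<close> outside
  \<open>X \<times> X\<close> are irrelevant.
\<close>

definition reverse_triangle_on :: "'a set \<Rightarrow> ('a \<times> 'a \<Rightarrow> real) \<Rightarrow> bool" where
  "reverse_triangle_on X d \<longleftrightarrow>
     (\<forall>x\<in>X. \<forall>y\<in>X. \<forall>z\<in>X. d (x, y) > 0 \<longrightarrow> d (y, z) > 0 \<longrightarrow> d (x, z) \<ge> d (x, y) + d (y, z))"

definition distinguishing_on :: "'a set \<Rightarrow> ('a \<times> 'a \<Rightarrow> real) \<Rightarrow> bool" where
  "distinguishing_on X d \<longleftrightarrow>
     (\<forall>x\<in>X. \<forall>y\<in>X. x \<noteq> y \<longrightarrow> (\<exists>z\<in>X. d (x, z) \<noteq> d (y, z) \<or> d (z, x) \<noteq> d (z, y)))"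

definition causet :: "'a set \<Rightarrow> ('a \<times> 'a \<Rightarrow> real) \<Rightarrow> bool" where
  "causet S d \<longleftrightarrow>
     finite S \<and> d \<in> S \<times> S \<rightarrow> {0..} \<and> reverse_triangle_on S d \<and> distinguishing_on S d"

definition admissible_topology :: "'a set \<Rightarrow> ('a \<times> 'a \<Rightarrow> real) \<Rightarrow> 'a topology \<Rightarrow> bool" where
  "admissible_topology X d T \<longleftrightarrow>
     topspace T = X \<and>
     continuous_map (prod_topology T T) (top_of_set {0..}) d \<and>
     (\<forall>\<epsilon>>0. compactin (prod_topology T T) {(p, q) \<in> X \<times> X. d (p, q) \<ge> \<epsilon>})"

definition bounded_Lorentzian_metric_space :: "'a set \<Rightarrow> ('a \<times> 'a \<Rightarrow> real) \<Rightarrow> bool" where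
  "bounded_Lorentzian_metric_space X d \<longleftrightarrow>
     d \<in> X \<times> X \<rightarrow> {0..} \<and> reverse_triangle_on X d \<and>
     (\<exists>T. admissible_topology X d T) \<and> distinguishing_on X d"

text \<open>
  The conjunct \<open>U \<subseteq> X\<close> is only needed for the intersection of an empty family of topologies,
  which does not occur for a bounded Lorentzian-metric space.
\<close>

definition Lorentzian_topology :: "'a set \<Rightarrow> ('a \<times> 'a \<Rightarrow> real) \<Rightarrow> 'a topology" where
  "Lorentzian_topology X d =
     topology (\<lambda>U. U \<subseteq> X \<and> (\<forall>T. admissible_topology X d T \<longrightarrow> openin T U))"

lemma openin_Lorentzian_topology:
  "openin (Lorentzian_topology X d) U \<longleftrightarrow>
     U \<subseteq> X \<and> (\<forall>T. admissible_topology X d T \<longrightarrow> openin T U)"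
proof -
  have "istopology (\<lambda>U. U \<subseteq> X \<and> (\<forall>T. admissible_topology X d T \<longrightarrow> openin T U))"
    unfolding istopology_def by (auto intro: openin_Int)
  then show ?thesis
    by (simp add: Lorentzian_topology_def topology_inverse')
qed

end

theory Submission imports Defs begin

text \<open>
  The slices \<open>d (\<cdot>, z)\<close> and \<open>d (z, \<cdot>)\<close> are continuous for every admissible topology, and the
  distinguishing property says that together they separate points. Hence every admissible topology
  is Hausdorff (\<open>Hausdorff_space_admissible_topology\<close>). On a finite set the only Hausdorff topology
  is the discrete one, and conversely the discrete topology on a finite set makes every function
  continuous and every subset compact (\<open>admissible_discrete_topology\<close>). So a causet has exactly one
  admissible topology, the discrete one, and this is therefore the intersection of all of them.
\<close>

lemma Hausdorff_space_if_separating_continuous_maps: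
  fixes T :: "'a topology" and Y :: "'b topology"
  assumes "Hausdorff_space Y"
    and separating: "\<And>x y. x \<in> topspace T \<Longrightarrow> y \<in> topspace T \<Longrightarrow> x \<noteq> y \<Longrightarrow>
      \<exists>f. continuous_map T Y f \<and> f x \<noteq> f y"
  shows "Hausdorff_space T"
  unfolding Hausdorff_space_def
proof (intro allI impI, elim conjE)
  fix x y
  assume xy: "x \<in> topspace T" "y \<in> topspace T" "x \<noteq> y"
  then obtain f where f: "continuous_map T Y f" "f x \<noteq> f y"
    using separating by blast
  have "f x \<in> topspace Y" "f y \<in> topspace Y"
    using f(1) xy by (auto simp: continuous_map_def)
  then obtain U V where UV: "openin Y U" "openin Y V" "f x \<in> U" "f y \<in> V" "disjnt U V"
    using assms(1) f(2) unfolding Hausdorff_space_def by metis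
  let ?pre = "\<lambda>W. {p \<in> topspace T. f p \<in> W}"
  have "openin T (?pre U)" "openin T (?pre V)"
    using f(1) UV(1,2) by (auto intro: openin_continuous_map_preimage)
  moreover have "x \<in> ?pre U" "y \<in> ?pre V" "disjnt (?pre U) (?pre V)"
    using xy UV by (auto simp: disjnt_iff)
  ultimately show "\<exists>U V. openin T U \<and> openin T V \<and> x \<in> U \<and> y \<in> V \<and> disjnt U V"
    by blast
qed

lemma continuous_map_slices_admissible:
  assumes T: "admissible_topology X d T" and "z \<in> X"
  shows "continuous_map T euclideanreal (\<lambda>p. d (p, z))"
    and "continuous_map T euclideanreal (\<lambda>p. d (z, p))"
proof -
  have d: "continuous_map (prod_topology T T) euclideanreal d" and z: "z \<in> topspace T"
    using assms by (auto simp: admissible_topology_def continuous_map_in_subtopology)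
  have "continuous_map T (prod_topology T T) (\<lambda>p. (p, z))"
    and "continuous_map T (prod_topology T T) (\<lambda>p. (z, p))"
    using z by (auto intro!: continuous_map_pairedI)
  then show "continuous_map T euclideanreal (\<lambda>p. d (p, z))"
    and "continuous_map T euclideanreal (\<lambda>p. d (z, p))"
    using d by (auto dest: continuous_map_compose simp: o_def)
qed

text \<open>
  The points \<open>z\<close> that the distinguishing property supplies give slices of \<open>d\<close> that separate points.
\<close>

lemma Hausdorff_space_admissible_topology:
  assumes T: "admissible_topology X d T" and "distinguishing_on X d"
  shows "Hausdorff_space T"
proof (rule Hausdorff_space_if_separating_continuous_maps)
  show "Hausdorff_space euclideanreal"
    by simp
next
  fix x y
  assume "x \<in> topspace T" "y \<in> topspace T" "x \<noteq> y"
  then obtain z where "z \<in> X" "d (x, z) \<noteq> d (y, z) \<or> d (z, x) \<noteq> d (z, y)"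
    using assms unfolding admissible_topology_def distinguishing_on_def by blast
  then show "\<exists>f. continuous_map T euclideanreal f \<and> f x \<noteq> f y"
    using continuous_map_slices_admissible[OF T] by blast
qed

lemma admissible_discrete_topology:
  assumes "finite X" and "d \<in> X \<times> X \<rightarrow> {0..}"
  shows "admissible_topology X d (discrete_topology X)"
proof -
  have "finite {(p, q) \<in> X \<times> X. d (p, q) \<ge> \<epsilon>}" for \<epsilon>
    by (rule finite_subset[of _ "X \<times> X"]) (use assms(1) in auto)
  then show ?thesis
    using assms(2)
    by (auto simp: admissible_topology_def compactin_discrete_topology
        simp flip: prod_topology_discrete_topology)
qed

text \<open>
  Uniqueness holds because finite \<open>T\<^sub>1\<close> spaces are discrete: the complement of a point is a finite
  union of closed points.
\<close>

lemma admissible_topology_causet_iff: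
  assumes "causet S d"
  shows "admissible_topology S d T \<longleftrightarrow> T = discrete_topology S"
proof
  assume T: "admissible_topology S d T"
  then have "t1_space T"
    using assms Hausdorff_space_admissible_topology Hausdorff_imp_t1_space
    by (auto simp: causet_def)
  then show "T = discrete_topology S"
    using T assms finite_t1_space_imp_discrete_topology
    by (auto simp: admissible_topology_def causet_def)
next
  assume "T = discrete_topology S"
  then show "admissible_topology S d T"
    using assms admissible_discrete_topology by (auto simp: causet_def)
qed

theorem proposition2p2:
  fixes S :: "'a set" and d :: "'a \<times> 'a \<Rightarrow> real"
  assumes "causet S d"
  shows "bounded_Lorentzian_metric_space S d \<and> Lorentzian_topology S d = discrete_topology S"
proof
  show "bounded_Lorentzian_metric_space S d"
    using assms admissible_topology_causet_iff[OF assms]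
    by (auto simp: bounded_Lorentzian_metric_space_def causet_def)
  show "Lorentzian_topology S d = discrete_topology S"
    by (auto simp: topology_eq openin_Lorentzian_topology admissible_topology_causet_iff[OF assms])
qed

end
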